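(* Let $G$ be an $n$-vertex $d$-regular simple graph with $d\ge 1$, and define $\lambda':=\min\{\lambda_1(G),\,2d-\lambda_{n-1}(G)\}$. Then for all weight vectors $x\in\mathbb{R}^{V(G)}$ and all integers $t\ge 1$, \[\mathbb{E}\left[\|\tilde{R}^t(x)-\overline{x}\|_2^2\right]\le\left(1-\frac{\lambda'(2d-\lambda')}{dn}\right)^t\|x-\overline{x}\|_2^2.\]
   Context: $G$ is a finite simple graph and $\lambda_0(G)\le\lambda_1(G)\le\cdots\le\lambda_{n-1}(G)$ are the eigenvalues, with multiplicity, of its combinatorial Laplacian $L(G)$ (degree matrix minus adjacency matrix). $N_G(u)$ is the set of vertices adjacent to $u$. A weight vector of $G$ is a real vector $x=(x_v)_{v\in V(G)}$. In the neighborhood averaging process, the random vector $\tilde{R}(x)$ is obtained by choosing $u\in V(G)$ uniformly at random and setting $\tilde{R}(x)_v=x_v$ if $v\notin N_G(u)$ and $\tilde{R}(x)_v=\frac{1}{|N_G(u)|}\sum_{w\in N_G(u)}x_w$ if $v\in N_G(u)$. Recursively, $\tilde R^1(x)=\tilde R(x)$ and $\tilde{R}^t(x)=\tilde{R}(\tilde{R}^{t-1}(x))$ with independent choices at each step. $\overline{x}$ is the vector all of whose coordinates equal $\frac1n\sum_u x_u$. *)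

theory Defs
  imports
    "HOL-Analysis.Analysis"
    "HOL-Probability.Probability_Mass_Function"
    "HOL-Computational_Algebra.Polynomial"
begin

text \<open>
  The vertex set of a graph is a finite type \<open>'v\<close>, so that weight vectors are
  elements of \<open>real ^ 'v\<close>, and \<open>CARD('v)\<close> is the number of vertices.
\<close>

definition simple_graph :: "('v::finite \<Rightarrow> 'v \<Rightarrow> bool) \<Rightarrow> bool" where
  "simple_graph E \<longleftrightarrow> symp E \<and> irreflp E"

definition nbhd :: "('v::finite \<Rightarrow> 'v \<Rightarrow> bool) \<Rightarrow> 'v \<Rightarrow> 'v set" where
  "nbhd E u = {v. E u v}"

definition vertex_degree :: "('v::finite \<Rightarrow> 'v \<Rightarrow> bool) \<Rightarrow> 'v \<Rightarrow> nat" where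
  "vertex_degree E u = card (nbhd E u)"

definition regular_graph :: "('v::finite \<Rightarrow> 'v \<Rightarrow> bool) \<Rightarrow> nat \<Rightarrow> bool" where
  "regular_graph E d \<longleftrightarrow> (\<forall>u. vertex_degree E u = d)"

definition degree_matrix :: "('v::finite \<Rightarrow> 'v \<Rightarrow> bool) \<Rightarrow> real ^ 'v ^ 'v" where
  "degree_matrix E = (\<chi> i j. if i = j then real (vertex_degree E i) else 0)"

definition adjacency_matrix :: "('v::finite \<Rightarrow> 'v \<Rightarrow> bool) \<Rightarrow> real ^ 'v ^ 'v" where
  "adjacency_matrix E = (\<chi> i j. if E i j then 1 else 0)"

definition laplacian :: "('v::finite \<Rightarrow> 'v \<Rightarrow> bool) \<Rightarrow> real ^ 'v ^ 'v" where
  "laplacian E = degree_matrix E - adjacency_matrix E"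

definition charpoly :: "real ^ 'v ^ 'v \<Rightarrow> real poly" where
  "charpoly A = det (mat [:0, 1:] - (\<chi> i j. [:A $ i $ j:]))"

text \<open>
  The real eigenvalues of a matrix in ascending order, each repeated according to
  its algebraic multiplicity. For a symmetric matrix such as a graph Laplacian the
  characteristic polynomial splits over the reals, so the list has length
  \<open>CARD('v)\<close> and its entries are indexed by \<open>0, \<dots>, CARD('v) - 1\<close>.
\<close>

definition eigenvalue_list :: "real ^ 'v ^ 'v \<Rightarrow> real list" where
  "eigenvalue_list A = sorted_list_of_multiset (proots (charpoly A))"

definition lap_eigenvalue :: "('v::finite \<Rightarrow> 'v \<Rightarrow> bool) \<Rightarrow> nat \<Rightarrow> real" where
  "lap_eigenvalue E k = eigenvalue_list (laplacian E) ! k"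

definition mean_vec :: "real ^ 'v \<Rightarrow> real ^ ('v::finite)" where
  "mean_vec x = (\<chi> v. (\<Sum>u\<in>UNIV. x $ u) / real CARD('v))"

definition nbhd_average ::
    "('v::finite \<Rightarrow> 'v \<Rightarrow> bool) \<Rightarrow> 'v \<Rightarrow> real ^ 'v \<Rightarrow> real ^ 'v" where
  "nbhd_average E u x =
    (\<chi> v. if v \<in> nbhd E u
         then (\<Sum>w\<in>nbhd E u. x $ w) / real (card (nbhd E u))
         else x $ v)"

definition averaging_step ::
    "('v::finite \<Rightarrow> 'v \<Rightarrow> bool) \<Rightarrow> real ^ 'v \<Rightarrow> (real ^ 'v) pmf" where
  "averaging_step E x = map_pmf (\<lambda>u. nbhd_average E u x) (pmf_of_set UNIV)"

text \<open>
  The law of the process after \<open>t\<close> steps. The monadic bind draws the vertex of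
  each step independently of the earlier ones. The process starts at \<open>t = 0\<close> with
  the deterministic vector \<open>x\<close>, so that one step has law \<open>averaging_step E x\<close>.
\<close>

primrec averaging_process ::
    "('v::finite \<Rightarrow> 'v \<Rightarrow> bool) \<Rightarrow> nat \<Rightarrow> real ^ 'v \<Rightarrow> (real ^ 'v) pmf" where
  "averaging_process E 0 x = return_pmf x"
| "averaging_process E (Suc t) x = bind_pmf (averaging_process E t x) (averaging_step E)"

lemma averaging_process_1: "averaging_process E 1 x = averaging_step E x"
  by (simp add: bind_return_pmf)

end

(*
  For a mean-zero x, averaging over the random vertex gives
    E |R(x)|^2 = (1 - d/n) |x|^2 + |A x|^2 / (d n),   A = d I - L the adjacency matrix.
  The eigenvalues of A on the mean-zero vectors are d - lambda_i with i >= 1, all of modulus at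
  most d - lambda', so |A x| <= (d - lambda') |x| and one step contracts by the stated factor.
  Since every step preserves the mean, the estimate iterates.
*)

theory Submission
  imports Defs
begin

section \<open>Orthonormal eigenbases and the characteristic polynomial\<close>

text \<open>Maximise the quadratic form \<open>x \<bullet> f x\<close> over the unit sphere of
  \<open>S\<close>, which is compact. A maximiser is an eigenvector, since otherwise moving it along
  the residual \<open>f v - m v\<close> would increase the form to first order.\<close>

lemma self_adjoint_eigenvector:
  fixes f :: "'a::euclidean_space \<Rightarrow> 'a"
  assumes lin: "linear f" and adj: "\<And>x y. f x \<bullet> y = x \<bullet> f y"
    and S: "subspace S" "f ` S \<subseteq> S" "S \<noteq> {0}"
  obtains v where "v \<in> S" "norm v = 1" "f v = (v \<bullet> f v) *\<^sub>R v"
proof -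
  define K where "K = S \<inter> sphere 0 1"
  have "compact K"
    unfolding K_def using closed_subspace[OF S(1)] by (simp add: closed_Int_compact)
  moreover have "K \<noteq> {}"
  proof -
    obtain w where w: "w \<in> S" "w \<noteq> 0"
      using S(1,3) subspace_0 by blast
    then have "(1 / norm w) *\<^sub>R w \<in> K"
      unfolding K_def using S(1) by (simp add: subspace_scale)
    then show ?thesis by blast
  qed
  moreover have "continuous_on K (\<lambda>x. x \<bullet> f x)"
    by (intro continuous_intros linear_continuous_on linear_conv_bounded_linear[THEN iffD1] lin)
  ultimately obtain v where v: "v \<in> K" and max: "\<And>y. y \<in> K \<Longrightarrow> y \<bullet> f y \<le> v \<bullet> f v"
    using continuous_attains_sup by metis
  have vS: "v \<in> S" and nv: "norm v = 1"
    using v by (auto simp: K_def)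
  define m where "m = v \<bullet> f v"
  \<comment> \<open>By homogeneity the maximum on the sphere controls the form on all of
    \<open>S\<close>.\<close>
  have quad: "w \<bullet> f w \<le> m * (w \<bullet> w)" if "w \<in> S" for w
  proof (cases "w = 0")
    case False
    have "(1 / norm w) *\<^sub>R w \<in> K"
      using that False S(1) by (simp add: K_def subspace_scale)
    from max[OF this] have "(w \<bullet> f w) / (norm w)\<^sup>2 \<le> m"
      using False by (simp add: linear_scale[OF lin] m_def power2_eq_square)
    then show ?thesis
      using False by (simp add: field_simps dot_square_norm)
  qed simp
  define u where "u = f v - m *\<^sub>R v"
  have uS: "u \<in> S"
    unfolding u_def using vS S(1,2) by (intro subspace_diff subspace_scale) auto
  define C where "C = m * (u \<bullet> u) - u \<bullet> f u"
  have C: "C \<ge> 0"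
    using quad[OF uS] by (simp add: C_def)
  \<comment> \<open>The bound \<open>quad\<close> at \<open>v + t u\<close>: the first-order gain is
    at most the second-order loss. Self-adjointness merges the two cross terms.\<close>
  have key: "2 * t * (u \<bullet> u) \<le> t\<^sup>2 * C" for t
  proof -
    have "v + t *\<^sub>R u \<in> S"
      using vS uS S(1) by (intro subspace_add subspace_scale)
    from quad[OF this]
    have "m + 2 * t * (u \<bullet> f v) + t\<^sup>2 * (u \<bullet> f u)
        \<le> m * (1 + 2 * t * (u \<bullet> v) + t\<^sup>2 * (u \<bullet> u))"
      using nv adj[of v u]
      by (simp add: linear_add[OF lin] linear_scale[OF lin] inner_add inner_commute[of v u]
          inner_commute[of "f v"] m_def norm_eq_1 power2_eq_square algebra_simps)
    then have "2 * t * (u \<bullet> f v - m * (u \<bullet> v)) \<le> t\<^sup>2 * C"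
      by (simp add: C_def algebra_simps)
    also have "u \<bullet> f v - m * (u \<bullet> v) = u \<bullet> u"
      by (subst (4) u_def) (simp add: inner_diff_right)
    finally show ?thesis .
  qed
  have "u \<bullet> u = 0"
  proof (rule ccontr)
    assume "u \<bullet> u \<noteq> 0"
    then have pos: "u \<bullet> u > 0" by simp
    \<comment> \<open>This \<open>t\<close> gives \<open>t * C \<le> u \<bullet> u\<close>, whereas
      \<open>key\<close> forces \<open>2 * (u \<bullet> u) \<le> t * C\<close>. The
      \<open>+ 1\<close> keeps the denominator positive when \<open>C = 0\<close>.\<close>
    define t where "t = (u \<bullet> u) / (C + 1)"
    have t: "t > 0" and tC: "t * (C + 1) = u \<bullet> u"
      using pos C by (auto simp: t_def)
    have "t * (2 * (u \<bullet> u)) \<le> t * (t * C)"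
      using key[of t] by (simp add: power2_eq_square algebra_simps)
    then have "2 * (u \<bullet> u) \<le> t * C"
      using t by simp
    moreover have "t * C \<le> u \<bullet> u"
      using tC t by (simp add: algebra_simps)
    ultimately show False using pos by simp
  qed
  then have "f v = m *\<^sub>R v"
    by (simp add: u_def)
  then show ?thesis
    using that vS nv by (simp add: m_def)
qed

text \<open>Removing from a vector of \<open>S\<close> its component along the unit vector
  \<open>v\<close> leaves a vector of \<open>S\<close> orthogonal to \<open>v\<close>.\<close>

lemma span_insert_orthogonal_section:
  fixes v :: "'a::euclidean_space"
  assumes "subspace S" "v \<in> S" "norm v = 1" "span B = {y \<in> S. v \<bullet> y = 0}"
  shows "span (insert v B) = S"
proof
  have "B \<subseteq> S"
    using assms(4) span_superset by blast
  then show "span (insert v B) \<subseteq> S"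
    using assms(1,2) by (simp add: span_minimal)
next
  show "S \<subseteq> span (insert v B)"
  proof
    fix x assume "x \<in> S"
    then have "x - (v \<bullet> x) *\<^sub>R v \<in> span B"
      using assms by (auto simp: inner_diff_right norm_eq_1 subspace_diff subspace_scale)
    then show "x \<in> span (insert v B)"
      unfolding span_insert by blast
  qed
qed

text \<open>Induction on dimension: split off one eigenvector; its orthogonal complement within
  \<open>S\<close> is again invariant because \<open>f\<close> is self-adjoint. The form for an
  invariant subspace allows the mean-zero vectors to be treated apart from the constants.\<close>

lemma self_adjoint_orthonormal_eigenbasis:
  fixes f :: "'a::euclidean_space \<Rightarrow> 'a"
  assumes lin: "linear f" and adj: "\<And>x y. f x \<bullet> y = x \<bullet> f y"
    and "subspace S" "f ` S \<subseteq> S"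
  shows "\<exists>B. finite B \<and> pairwise orthogonal B \<and> span B = S \<and>
    (\<forall>b\<in>B. norm b = 1 \<and> f b = (b \<bullet> f b) *\<^sub>R b)"
  using assms(3,4)
proof (induction "dim S" arbitrary: S rule: less_induct)
  case less
  show ?case
  proof (cases "S = {0}")
    case True
    then show ?thesis by (intro exI[of _ "{}"]) simp
  next
    case False
    obtain v where v: "v \<in> S" "norm v = 1" "f v = (v \<bullet> f v) *\<^sub>R v"
      using self_adjoint_eigenvector[OF lin adj less.prems False] .
    define T where "T = {y \<in> S. v \<bullet> y = 0}"
    have T: "subspace T"
      using less.prems(1) by (auto simp: T_def subspace_def inner_add_right)
    have "v \<notin> T"
      using v(2) by (simp add: T_def norm_eq_1)
    then have "T \<subset> S"
      using v(1) unfolding T_def by blast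
    then have "dim T < dim S"
      using T less.prems(1) dim_psubset[of T S] by (simp add: span_eq_iff[THEN iffD2])
    moreover have "f ` T \<subseteq> T"
    proof -
      have "v \<bullet> f y = 0" if "v \<bullet> y = 0" for y
        using adj[of v y] v(3) that by (metis inner_scaleR_left mult_zero_right)
      then show ?thesis
        using less.prems(2) by (auto simp: T_def)
    qed
    ultimately obtain B where B: "finite B" "pairwise orthogonal B" "span B = T"
      "\<forall>b\<in>B. norm b = 1 \<and> f b = (b \<bullet> f b) *\<^sub>R b"
      using less.hyps[OF _ T] by blast
    have "\<forall>b\<in>B. orthogonal v b"
      using B(3) span_superset by (fastforce simp: T_def orthogonal_def)
    then have "pairwise orthogonal (insert v B)"
      using B(2) by (auto simp: pairwise_insert orthogonal_commute)
    moreover have "span (insert v B) = S"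
      using span_insert_orthogonal_section[OF less.prems(1) v(1,2)] B(3) by (simp add: T_def)
    ultimately show ?thesis
      using B v by (intro exI[of _ "insert v B"]) auto
  qed
qed

section \<open>Roots of the characteristic polynomial from an orthonormal eigenbasis\<close>

lemma poly_det:
  fixes M :: "'a::comm_ring_1 poly ^ 'n ^ 'n"
  shows "poly (det M) a = det (\<chi> i j. poly (M $ i $ j) a)"
  by (simp add: det_def poly_sum poly_prod)

text \<open>This links algebraic multiplicities to eigenvectors. If \<open>P\<close> has the
  eigenbasis as columns and \<open>D\<close> is diagonal with entries \<open>a - ev b\<close>, then
  \<open>(a I - A) P = P D\<close> with \<open>P\<close> orthogonal, so the two determinants
  agree.\<close>

lemma proots_charpoly_eigenbasis:
  fixes A :: "real ^ 'n ^ 'n"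
  assumes "finite B" "pairwise orthogonal B" "span B = UNIV"
    and norm1: "\<And>b. b \<in> B \<Longrightarrow> norm b = 1"
    and eig: "\<And>b. b \<in> B \<Longrightarrow> A *v b = ev b *\<^sub>R b"
  shows "proots (charpoly A) = image_mset ev (mset_set B)"
proof -
  have "independent B"
    using assms(2) norm1 by (intro pairwise_orthogonal_independent) fastforce+
  then have "card B = CARD('n)"
    using indep_card_eq_dim_span[of B] assms(3) by simp
  then obtain f where f: "bij_betw f (UNIV :: 'n set) B"
    using assms(1) by (metis finite finite_same_card_bij)
  then have fB: "f i \<in> B" and f_inj: "f i = f j \<longleftrightarrow> i = j" for i j
    by (auto simp: bij_betw_def inj_eq)
  define P :: "real ^ 'n ^ 'n" where "P = (\<chi> i j. f j $ i)"
  have PP: "transpose P ** P = mat 1"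
  proof -
    have "f i \<bullet> f j = (if i = j then 1 else 0)" for i j
      using assms(2) fB[of i] fB[of j] norm1[OF fB[of i]] f_inj[of i j]
      by (auto simp: norm_eq_1 pairwise_def orthogonal_def)
    then show ?thesis
      by (simp add: P_def vec_eq_iff matrix_matrix_mult_def transpose_def mat_def inner_vec_def)
  qed
  \<comment> \<open>Evaluating at a real \<open>a\<close> leads to real matrices, where
    \<open>det P\<close> can be cancelled. Real polynomials with equal values everywhere are
    equal.\<close>
  have "poly (charpoly A) a = poly (\<Prod>i\<in>UNIV. [:- ev (f i), 1:]) a" for a
  proof -
    define D :: "real ^ 'n ^ 'n" where "D = (\<chi> i j. if i = j then a - ev (f j) else 0)"
    have "(mat a - A) ** P = P ** D"
    proof -
      have "((mat a - A) ** P) $ i $ j = (P ** D) $ i $ j" for i j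
      proof -
        have "((mat a - A) ** P) $ i $ j = ((mat a - A) *v f j) $ i"
          by (simp add: P_def matrix_matrix_mult_def matrix_vector_mult_def)
        also have "\<dots> = a * f j $ i - (A *v f j) $ i"
          by (simp add: matrix_vector_mult_def mat_def algebra_simps sum_subtractf
              if_distrib[of "\<lambda>z. _ * z"] cong: if_cong)
        also have "\<dots> = (P ** D) $ i $ j"
          using eig[OF fB[of j]]
          by (simp add: P_def D_def matrix_matrix_mult_def algebra_simps
              if_distrib[of "\<lambda>z. _ * z"] cong: if_cong)
        finally show ?thesis .
      qed
      then show ?thesis by (simp add: vec_eq_iff)
    qed
    then have "det (mat a - A) * det P = det P * det D"
      by (metis det_mul)
    moreover have "det P \<noteq> 0"
      using arg_cong[OF PP, of det] by (auto simp: det_mul)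
    ultimately have "det (mat a - A) = det D" by simp
    also have "\<dots> = (\<Prod>i\<in>UNIV. a - ev (f i))"
      by (subst det_diagonal) (auto simp: D_def)
    finally show ?thesis
      by (simp add: charpoly_def poly_det poly_prod mat_def if_distrib[of "\<lambda>p. poly p a"]
          minus_vec_def cong: if_cong)
  qed
  then have "charpoly A = (\<Prod>i\<in>UNIV. [:- ev (f i), 1:])"
    by (simp add: poly_eq_poly_eq_iff[symmetric] fun_eq_iff)
  then have "proots (charpoly A) = (\<Sum>i\<in>UNIV. {#ev (f i)#})"
    by (simp add: proots_prod)
  also have "\<dots> = (\<Sum>b\<in>B. {#ev b#})"
    by (rule sum.reindex_bij_betw[OF f])
  also have "\<dots> = image_mset ev (mset_set B)"
    using assms(1) by (induction B) auto
  finally show ?thesis .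
qed

lemma power2_norm_vec:
  fixes x :: "real ^ 'n"
  shows "(norm x)\<^sup>2 = (\<Sum>i\<in>UNIV. (x $ i)\<^sup>2)"
  by (simp only: power2_norm_eq_inner) (simp add: inner_vec_def power2_eq_square)

section \<open>The adjacency matrix of a regular graph on mean-zero vectors\<close>

lemma adjacency_matrix_vector_nth:
  "(adjacency_matrix E *v x) $ u = (\<Sum>w\<in>nbhd E u. x $ w)"
  by (simp add: adjacency_matrix_def matrix_vector_mult_def nbhd_def sum.If_cases
      if_distrib[of "\<lambda>z. z * _"] cong: if_cong)

lemma laplacian_regular_vector:
  assumes "regular_graph E d"
  shows "laplacian E *v x = real d *\<^sub>R x - adjacency_matrix E *v x"
  using assms
  by (simp add: vec_eq_iff laplacian_def degree_matrix_def regular_graph_def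
      matrix_vector_mult_def algebra_simps sum_subtractf
      if_distrib[of "\<lambda>z. _ * z"] cong: if_cong)

lemma nbhd_commute: "simple_graph E \<Longrightarrow> v \<in> nbhd E u \<longleftrightarrow> u \<in> nbhd E v"
  by (auto simp: simple_graph_def nbhd_def dest: sympD)

lemma adjacency_matrix_self_adjoint:
  assumes "simple_graph E"
  shows "(adjacency_matrix E *v x) \<bullet> y = x \<bullet> (adjacency_matrix E *v y)"
proof -
  have "transpose (adjacency_matrix E) = adjacency_matrix E"
    using assms by (auto simp: vec_eq_iff transpose_def adjacency_matrix_def simple_graph_def
        dest: sympD)
  then show ?thesis
    by (metis dot_lmul_matrix vector_transpose_matrix)
qed

text \<open>Double counting: by symmetry each \<open>w\<close> lies in the neighborhoods of exactly
  \<open>d\<close> vertices.\<close>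

lemma sum_sum_nbhd:
  assumes "simple_graph E" "regular_graph E d"
  shows "(\<Sum>u\<in>UNIV. \<Sum>w\<in>nbhd E u. f w) = real d * (\<Sum>w\<in>UNIV. f w)"
proof -
  have "(\<Sum>u\<in>UNIV. \<Sum>w\<in>nbhd E u. f w) = (\<Sum>u\<in>UNIV. \<Sum>w\<in>UNIV. if w \<in> nbhd E u then f w else 0)"
    by (simp add: sum.If_cases)
  also have "\<dots> = (\<Sum>w\<in>UNIV. \<Sum>u\<in>UNIV. if u \<in> nbhd E w then f w else 0)"
    by (subst sum.swap) (simp add: nbhd_commute[OF assms(1)])
  also have "\<dots> = (\<Sum>w\<in>UNIV. real d * f w)"
    using assms(2) by (simp add: sum.If_cases regular_graph_def vertex_degree_def)
  finally show ?thesis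
    by (simp add: sum_distrib_left)
qed

text \<open>Cauchy-Schwarz on each neighborhood, then double counting. The bound makes the Laplacian
  eigenvalues nonnegative, so that 0 is the least of them.\<close>

lemma norm_adjacency_matrix_vector_le:
  assumes "simple_graph E" "regular_graph E d"
  shows "norm (adjacency_matrix E *v x) \<le> real d * norm x"
proof (rule power2_le_imp_le)
  have "(norm (adjacency_matrix E *v x))\<^sup>2 = (\<Sum>u\<in>UNIV. (\<Sum>w\<in>nbhd E u. x $ w)\<^sup>2)"
    by (simp add: power2_norm_vec adjacency_matrix_vector_nth)
  also have "\<dots> \<le> (\<Sum>u\<in>UNIV. real d * (\<Sum>w\<in>nbhd E u. (x $ w)\<^sup>2))"
  proof (rule sum_mono)
    fix u
    show "(\<Sum>w\<in>nbhd E u. x $ w)\<^sup>2 \<le> real d * (\<Sum>w\<in>nbhd E u. (x $ w)\<^sup>2)"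
      using Cauchy_Schwarz_ineq_sum[of "\<lambda>_. 1" "\<lambda>w. x $ w" "nbhd E u"] assms(2)
      by (simp add: regular_graph_def vertex_degree_def)
  qed
  also have "\<dots> = (real d * norm x)\<^sup>2"
    using sum_sum_nbhd[OF assms, of "\<lambda>w. (x $ w)\<^sup>2"]
    by (simp add: power2_norm_vec power_mult_distrib power2_eq_square[of "real d"]
        flip: sum_distrib_left)
  finally show "(norm (adjacency_matrix E *v x))\<^sup>2 \<le> (real d * norm x)\<^sup>2" .
qed simp

section \<open>Least and extreme entries of a sorted multiset\<close>

lemma sorted_list_of_add_mset_least:
  assumes "\<And>y. y \<in># M \<Longrightarrow> a \<le> y"
  shows "sorted_list_of_multiset (add_mset a M) = a # sorted_list_of_multiset M"
  using assms by (simp add: insort_is_Cons[where f = "\<lambda>x. x"])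

lemma sorted_list_of_multiset_nth_bounds:
  fixes M :: "'a::linorder multiset"
  assumes "y \<in># M"
  shows "sorted_list_of_multiset M ! 0 \<le> y" "y \<le> sorted_list_of_multiset M ! (size M - 1)"
proof -
  have len: "length (sorted_list_of_multiset M) = size M"
    by (metis mset_sorted_list_of_multiset size_mset)
  obtain i where i: "i < size M" "y = sorted_list_of_multiset M ! i"
    using assms by (metis in_set_conv_nth len set_sorted_list_of_multiset)
  show "sorted_list_of_multiset M ! 0 \<le> y" "y \<le> sorted_list_of_multiset M ! (size M - 1)"
    using i len by (auto intro!: sorted_nth_mono)
qed

text \<open>
  The constant vector is an eigenvector of the Laplacian for its least eigenvalue 0, so the
  eigenvalues on its orthogonal complement are those of index \<open>1, \<dots>, n - 1\<close>, even when 0 is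
  a multiple eigenvalue.
\<close>

lemma adjacency_matrix_contraction:
  fixes E :: "'v::finite \<Rightarrow> 'v \<Rightarrow> bool" and x :: "real ^ 'v"
  assumes G: "simple_graph E" "regular_graph E d"
    and lam: "lam = min (lap_eigenvalue E 1) (2 * real d - lap_eigenvalue E (CARD('v) - 1))"
    and x0: "(\<Sum>v\<in>UNIV. x $ v) = 0"
  shows "(norm (adjacency_matrix E *v x))\<^sup>2 \<le> (real d - lam)\<^sup>2 * (norm x)\<^sup>2"
proof -
  let ?f = "\<lambda>x. adjacency_matrix E *v x"
  define n where "n = CARD('v)"
  have n: "n > 0" by (simp add: n_def)
  define e :: "real ^ 'v" where "e = (\<chi> i. 1 / sqrt (real n))"
  have e_dot: "e \<bullet> y = (\<Sum>v\<in>UNIV. y $ v) / sqrt (real n)" for y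
    by (simp add: e_def inner_vec_def sum_divide_distrib)
  have e1: "norm e = 1"
    using n by (simp add: norm_eq_1 e_dot) (simp add: e_def n_def real_div_sqrt)
  have fe: "?f e = real d *\<^sub>R e"
    using G(2) by (simp add: vec_eq_iff adjacency_matrix_vector_nth e_def regular_graph_def
        vertex_degree_def)
  \<comment> \<open>Since \<open>e\<close> is the normalised constant vector, \<open>T\<close> is
    the space of mean-zero vectors.\<close>
  define T where "T = {y. e \<bullet> y = 0}"
  have T: "subspace T"
    by (auto simp: T_def subspace_def inner_add_right)
  have "?f ` T \<subseteq> T"
    using fe by (auto simp: T_def simp flip: adjacency_matrix_self_adjoint[OF G(1)])
  then obtain B where B: "finite B" "pairwise orthogonal B" "span B = T"
    and eig: "\<And>b. b \<in> B \<Longrightarrow> norm b = 1" "\<And>b. b \<in> B \<Longrightarrow> ?f b = (b \<bullet> ?f b) *\<^sub>R b"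
    using self_adjoint_orthonormal_eigenbasis[OF matrix_vector_mul_linear
        adjacency_matrix_self_adjoint[OF G(1)] T] by blast
  \<comment> \<open>As the Laplacian is \<open>d I - A\<close>, this is the Laplacian eigenvalue of
    the eigenvector \<open>b\<close> of \<open>A\<close>.\<close>
  define ev where "ev b = real d - b \<bullet> ?f b" for b
  have "e \<notin> B" "\<forall>b\<in>B. orthogonal e b"
    using B(3) span_superset[of B] e1 by (auto simp: T_def orthogonal_def norm_eq_1)
  have span: "span (insert e B) = UNIV"
    using span_insert_orthogonal_section[of UNIV e B] e1 B(3) by (simp add: T_def)
  have ev_e: "ev e = 0"
    using e1 by (simp add: ev_def fe norm_eq_1)
  have ev_nonneg: "ev b \<ge> 0" if "b \<in> B" for b
  proof -
    have "b \<bullet> ?f b \<le> norm b * norm (?f b)"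
      by (rule norm_cauchy_schwarz)
    also have "\<dots> \<le> real d"
      using norm_adjacency_matrix_vector_le[OF G, of b] eig(1)[OF that] by simp
    finally show ?thesis by (simp add: ev_def)
  qed
  define M where "M = image_mset ev (mset_set B)"
  have "proots (charpoly (laplacian E)) = image_mset ev (mset_set (insert e B))"
  proof (rule proots_charpoly_eigenbasis)
    show "pairwise orthogonal (insert e B)"
      using B(2) \<open>\<forall>b\<in>B. orthogonal e b\<close> by (auto simp: pairwise_insert orthogonal_commute)
    show "laplacian E *v b = ev b *\<^sub>R b" if "b \<in> insert e B" for b
    proof (cases "b = e")
      case True
      then show ?thesis
        using ev_e by (simp add: laplacian_regular_vector[OF G(2)] fe)
    next
      case False
      then have "?f b = (b \<bullet> ?f b) *\<^sub>R b"
        using that eig(2) by blast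
      then show ?thesis
        by (metis ev_def laplacian_regular_vector[OF G(2)] scaleR_diff_left)
    qed
  qed (use B span e1 eig(1) in auto)
  \<comment> \<open>One zero is contributed by \<open>e\<close>. The rest, \<open>M\<close>, is
    nonnegative, so this zero can be taken as the head of the sorted list and entry
    \<open>k + 1\<close> of the list is entry \<open>k\<close> of \<open>M\<close>.\<close>
  also have "\<dots> = add_mset 0 M"
    using B(1) \<open>e \<notin> B\<close> by (simp add: M_def ev_e)
  finally have list: "eigenvalue_list (laplacian E) = 0 # sorted_list_of_multiset M"
    using ev_nonneg B(1)
    by (auto simp: eigenvalue_list_def M_def simp del: sorted_list_of_multiset_insert
        intro!: sorted_list_of_add_mset_least)
  have "0 \<notin> insert e B"
    using e1 eig(1)[of 0] by auto
  then have "independent (insert e B)"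
    using B(2) \<open>\<forall>b\<in>B. orthogonal e b\<close>
    by (intro pairwise_orthogonal_independent) (auto simp: pairwise_insert orthogonal_commute)
  then have "card (insert e B) = n"
    using indep_card_eq_dim_span[of "insert e B"] span by (simp add: n_def)
  then have size: "size M = n - 1"
    using B(1) \<open>e \<notin> B\<close> by (simp add: M_def)
  have bound: "(b \<bullet> ?f b)\<^sup>2 \<le> (real d - lam)\<^sup>2" if "b \<in> B" for b
  proof -
    have ev_M: "ev b \<in># M"
      using that B(1) by (simp add: M_def)
    \<comment> \<open>With \<open>M\<close> nonempty, \<open>n - 1\<close> is at least 1, so both
      indices 1 and \<open>n - 1\<close> fall behind the leading zero and pick out the first and
      last entries of \<open>M\<close>. On a single vertex \<open>B\<close> is empty and nothing is
      claimed.\<close>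
    then have "size M > 0"
      by (cases M) auto
    then have "lap_eigenvalue E 1 \<le> ev b" "ev b \<le> lap_eigenvalue E (CARD('v) - 1)"
      using sorted_list_of_multiset_nth_bounds[OF ev_M] size
      by (auto simp: lap_eigenvalue_def list nth_Cons' simp flip: n_def)
    \<comment> \<open>Here \<open>b \<bullet> A b = d - ev b\<close>. The lower bound on
      \<open>ev b\<close> gives at most \<open>d - lam\<close>, the upper bound gives at least
      \<open>-(d - lam)\<close>.\<close>
    then have "\<bar>b \<bullet> ?f b\<bar> \<le> real d - lam"
      by (auto simp: lam ev_def)
    then show ?thesis
      by (metis abs_ge_zero power2_abs power_mono)
  qed
  have xT: "x \<in> span B"
    using x0 by (simp add: B(3) T_def e_dot)
  define c where "c b = x \<bullet> b" for b
  have x_eq: "x = (\<Sum>b\<in>B. c b *\<^sub>R b)"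
    unfolding c_def using orthonormal_basis_expand[OF B(2) eig(1) xT B(1)] by simp
  \<comment> \<open>Parseval for \<open>B\<close>, applied below to the coordinates of
    \<open>x\<close> and to those of \<open>A x\<close>, which are rescaled by the eigenvalues of
    \<open>A\<close>.\<close>
  have norm_sum: "(norm (\<Sum>b\<in>B. g b *\<^sub>R b))\<^sup>2 = (\<Sum>b\<in>B. (g b)\<^sup>2)" for g
  proof -
    have "pairwise (\<lambda>b b'. orthogonal (g b *\<^sub>R b) (g b' *\<^sub>R b')) B"
      using B(2) by (auto simp: pairwise_def orthogonal_def)
    then show ?thesis
      using eig(1) by (simp add: norm_sum_Pythagorean[OF B(1)] power_mult_distrib)
  qed
  have "?f x = (\<Sum>b\<in>B. c b *\<^sub>R ?f b)"
    by (subst x_eq) (simp add: linear_sum[OF matrix_vector_mul_linear] matrix_vector_mult_scaleR)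
  also have "\<dots> = (\<Sum>b\<in>B. (c b * (b \<bullet> ?f b)) *\<^sub>R b)"
    by (intro sum.cong refl) (metis eig(2) scaleR_scaleR)
  finally have "(norm (?f x))\<^sup>2 = (\<Sum>b\<in>B. (c b * (b \<bullet> ?f b))\<^sup>2)"
    by (simp only: norm_sum)
  also have "\<dots> \<le> (\<Sum>b\<in>B. (real d - lam)\<^sup>2 * (c b)\<^sup>2)"
    using bound by (intro sum_mono) (simp add: power_mult_distrib mult.commute mult_left_mono)
  also have "\<dots> = (real d - lam)\<^sup>2 * (norm x)\<^sup>2"
    using norm_sum[of c] by (simp add: sum_distrib_left flip: x_eq)
  finally show ?thesis .
qed

section \<open>The averaging process\<close>

text \<open>Averaging is linear and fixes constant vectors, so distances to the mean reduce to norms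
  of mean-zero vectors.\<close>

lemma nbhd_average_diff_mean_vec:
  "card (nbhd E u) > 0 \<Longrightarrow>
    nbhd_average E u y - mean_vec x = nbhd_average E u (y - mean_vec x)"
  by (simp add: vec_eq_iff nbhd_average_def mean_vec_def sum_subtractf diff_divide_distrib)

lemma sum_UNIV_split_nbhd:
  fixes f :: "'v::finite \<Rightarrow> real"
  shows "(\<Sum>v\<in>UNIV. if v \<in> nbhd E u then g v else f v)
    = (\<Sum>v\<in>UNIV. f v) - (\<Sum>v\<in>nbhd E u. f v) + (\<Sum>v\<in>nbhd E u. g v)"
proof -
  have "(\<Sum>v\<in>UNIV. f v) = (\<Sum>v\<in>nbhd E u. f v) + (\<Sum>v\<in>- nbhd E u. f v)"
    by (subst sum.union_disjoint[symmetric]) auto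
  then show ?thesis
    by (simp add: sum.If_cases)
qed

lemma mean_vec_nbhd_average:
  assumes "card (nbhd E u) > 0"
  shows "mean_vec (nbhd_average E u x) = mean_vec x"
  using assms by (simp add: mean_vec_def nbhd_average_def sum_UNIV_split_nbhd)

text \<open>The squares over the neighborhood are replaced by equally many copies of the squared
  average. With \<open>k\<close> neighbors of sum \<open>s\<close>, these copies add up to
  \<open>k * (s / k)^2 = s^2 / k\<close>, and \<open>s\<close> is the entry of \<open>A x\<close> at
  \<open>u\<close>.\<close>

lemma norm_nbhd_average:
  assumes "card (nbhd E u) > 0"
  shows "(norm (nbhd_average E u x))\<^sup>2 =
    (norm x)\<^sup>2 - (\<Sum>w\<in>nbhd E u. (x $ w)\<^sup>2)
    + ((adjacency_matrix E *v x) $ u)\<^sup>2 / real (card (nbhd E u))"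
proof -
  have "(norm (nbhd_average E u x))\<^sup>2 =
    (\<Sum>v\<in>UNIV. if v \<in> nbhd E u
       then ((\<Sum>w\<in>nbhd E u. x $ w) / real (card (nbhd E u)))\<^sup>2 else (x $ v)\<^sup>2)"
    unfolding power2_norm_vec by (intro sum.cong) (auto simp: nbhd_average_def)
  then show ?thesis
    using assms unfolding sum_UNIV_split_nbhd
    by (simp add: adjacency_matrix_vector_nth power2_norm_vec power_divide)
      (simp add: power2_eq_square)
qed

lemma expectation_averaging_step_le:
  fixes E :: "'v::finite \<Rightarrow> 'v \<Rightarrow> bool" and y :: "real ^ 'v"
  assumes G: "simple_graph E" "regular_graph E d" and d: "d \<ge> 1"
    and lam: "lam = min (lap_eigenvalue E 1) (2 * real d - lap_eigenvalue E (CARD('v) - 1))"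
  shows "measure_pmf.expectation (averaging_step E y) (\<lambda>z. (norm (z - mean_vec y))\<^sup>2)
    \<le> (1 - lam * (2 * real d - lam) / (real d * real CARD('v))) * (norm (y - mean_vec y))\<^sup>2"
proof -
  let ?n = "real CARD('v)"
  define x where "x = y - mean_vec y"
  have deg: "card (nbhd E u) = d" for u
    using G(2) by (simp add: regular_graph_def vertex_degree_def)
  have x0: "(\<Sum>v\<in>UNIV. x $ v) = 0"
    by (simp add: x_def mean_vec_def sum_subtractf)
  have "measure_pmf.expectation (averaging_step E y) (\<lambda>z. (norm (z - mean_vec y))\<^sup>2)
    = (\<Sum>u\<in>UNIV. (norm (nbhd_average E u x))\<^sup>2) / ?n"
    using d by (simp add: averaging_step_def integral_pmf_of_set nbhd_average_diff_mean_vec deg x_def)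
  \<comment> \<open>Double counting turns the summed neighborhood squares into \<open>d\<close>
    times the squared norm of \<open>x\<close>.\<close>
  also have "(\<Sum>u\<in>UNIV. (norm (nbhd_average E u x))\<^sup>2)
    = ?n * (norm x)\<^sup>2 - real d * (norm x)\<^sup>2 + (norm (adjacency_matrix E *v x))\<^sup>2 / real d"
    using d sum_sum_nbhd[OF G, of "\<lambda>w. (x $ w)\<^sup>2"]
    by (simp add: norm_nbhd_average deg sum.distrib sum_subtractf
        power2_norm_vec[of "adjacency_matrix E *v x"] power2_norm_vec[of x]
        flip: sum_divide_distrib)
  also have "\<dots> / ?n \<le>
    (?n * (norm x)\<^sup>2 - real d * (norm x)\<^sup>2 + (real d - lam)\<^sup>2 * (norm x)\<^sup>2 / real d) / ?n"
    using adjacency_matrix_contraction[OF G lam x0] by (intro divide_right_mono add_mono) auto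
  \<comment> \<open>This rests on
    \<open>d - (d - lam)^2 / d = lam * (2 * d - lam) / d\<close>.\<close>
  also have "\<dots> = (1 - lam * (2 * real d - lam) / (real d * ?n)) * (norm x)\<^sup>2"
    using d by (simp add: field_simps power2_eq_square)
  finally show ?thesis
    by (simp add: x_def)
qed

section \<open>Iterating the one-step bound\<close>

lemma finite_set_averaging_process: "finite (set_pmf (averaging_process E t x))"
  by (induction t) (auto simp: averaging_step_def)

lemma mean_vec_averaging_process:
  assumes "\<And>u. card (nbhd E u) > 0" "y \<in> set_pmf (averaging_process E t x)"
  shows "mean_vec y = mean_vec x"
  using assms(2)
  by (induction t arbitrary: y) (auto simp: averaging_step_def mean_vec_nbhd_average[OF assms(1)])

text \<open>Completing the square gives \<open>lam * (2 * d - lam) = d^2 - (d - lam)^2\<close>,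
  which is at most \<open>d^2\<close> and hence at most \<open>d * n\<close>. The sign is needed to
  multiply the induction hypothesis by the factor.\<close>

lemma contraction_factor_nonneg:
  fixes d n :: nat and lam :: real
  assumes "1 \<le> d" "d \<le> n"
  shows "0 \<le> 1 - lam * (2 * real d - lam) / (real d * real n)"
proof -
  have "lam * (2 * real d - lam) \<le> (real d)\<^sup>2"
    using zero_le_power2[of "real d - lam"] by (simp add: power2_eq_square algebra_simps)
  also have "\<dots> \<le> real d * real n"
    using assms by (simp add: power2_eq_square)
  finally show ?thesis
    using assms by (simp add: field_simps)
qed

theorem theorem1p4:
  fixes E :: "'v::finite \<Rightarrow> 'v \<Rightarrow> bool" and n d t :: nat
    and lam :: real and x :: "real ^ 'v"
  assumes "simple_graph E"
    and "n = CARD('v)"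
    and "regular_graph E d"
    and "d \<ge> 1"
    and "lam = min (lap_eigenvalue E 1) (2 * real d - lap_eigenvalue E (n - 1))"
    and "t \<ge> 1"
  shows "measure_pmf.expectation (averaging_process E t x)
           (\<lambda>y. (norm (y - mean_vec x))\<^sup>2)
         \<le> (1 - lam * (2 * real d - lam) / (real d * real n)) ^ t
            * (norm (x - mean_vec x))\<^sup>2"
proof -
  define c where "c = 1 - lam * (2 * real d - lam) / (real d * real n)"
  have deg: "card (nbhd E u) = d" for u
    using assms(3) by (simp add: regular_graph_def vertex_degree_def)
  have "d \<le> n"
    using card_mono[of UNIV "nbhd E undefined"] by (simp add: deg assms(2))
  then have c: "c \<ge> 0"
    unfolding c_def using assms(4) by (intro contraction_factor_nonneg)
  have "measure_pmf.expectation (averaging_process E t x) (\<lambda>y. (norm (y - mean_vec x))\<^sup>2)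
    \<le> c ^ t * (norm (x - mean_vec x))\<^sup>2"
  proof (induction t)
    case (Suc t)
    let ?P = "averaging_process E t x" and ?h = "\<lambda>y. (norm (y - mean_vec x))\<^sup>2"
    \<comment> \<open>Condition on the state \<open>y\<close> after \<open>t\<close> steps; finite
      support makes the outer expectation a finite sum.\<close>
    have "measure_pmf.expectation (averaging_process E (Suc t) x) ?h
      = (\<Sum>y\<in>set_pmf ?P. pmf ?P y *\<^sub>R measure_pmf.expectation (averaging_step E y) ?h)"
      unfolding averaging_process.simps
      by (rule pmf_expectation_bind) (auto simp: finite_set_averaging_process averaging_step_def)
    also have "\<dots> \<le> (\<Sum>y\<in>set_pmf ?P. pmf ?P y *\<^sub>R (c * ?h y))"
    proof (intro sum_mono scaleR_left_mono)
      fix y assume "y \<in> set_pmf ?P"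
      \<comment> \<open>The one-step bound is centred at the mean of \<open>y\<close>; invariance of
        the mean makes this the fixed centre of \<open>?h\<close>.\<close>
      then have "mean_vec y = mean_vec x"
        using assms(4) by (intro mean_vec_averaging_process) (auto simp: deg)
      then show "measure_pmf.expectation (averaging_step E y) ?h \<le> c * ?h y"
        using expectation_averaging_step_le[OF assms(1,3,4) assms(5)[unfolded assms(2)], of y]
        by (simp add: c_def assms(2))
    qed simp
    also have "\<dots> = c * measure_pmf.expectation ?P ?h"
      by (subst integral_measure_pmf[of "set_pmf ?P"])
        (auto simp: finite_set_averaging_process sum_distrib_left mult_ac)
    also have "\<dots> \<le> c ^ Suc t * (norm (x - mean_vec x))\<^sup>2"
      using mult_left_mono[OF Suc c] by (simp add: mult.assoc)
    finally show ?case .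
  qed simp
  then show ?thesis
    by (simp add: c_def)
qed

end
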